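(* Let $\varphi$ be a convex function with $L$-Lipschitz-continuous gradient, let $\Lambda$ be a closed convex set, and let the sequences $\{\lambda_k,\eta_k,\zeta_k,\alpha_k,C_k\}$, $k\ge 0$, be generated by the Adaptive Similar Triangles Method (ASTM) described in the context, started with an initial guess $L_0>0$. Then, for all $k\ge 0$, $$C_k\varphi(\eta_k)\le \min_{\lambda\in\Lambda}\left\{\sum_{i=0}^k\alpha_i\left(\varphi(\lambda_i)+\langle\nabla\varphi(\lambda_i),\lambda-\lambda_i\rangle\right)+V[\zeta_0](\lambda)\right\}.$$ Moreover, the number of oracle calls after the iteration $k\ge 0$ (i.e. during the outer iterations $0,1,\dots,k$) does not exceed $$4k+4+2\log_2\left(\frac{L}{L_0}\right),$$ where $L$ is the Lipschitz constant for the gradient of $\varphi$.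
   Context: Setting. $E$ is a finite-dimensional real vector space with norm $\|\cdot\|$ and dual norm $\|\cdot\|_*$ on $E^*$; $\langle g,x\rangle$ is the value of $g\in E^*$ at $x\in E$. $\Lambda\subseteq E$ is a nonempty closed convex (possibly unbounded) set. $\varphi:E\to\mathbb{R}$ is convex and differentiable, with $\|\nabla\varphi(x)-\nabla\varphi(y)\|_*\le L\|x-y\|$ for all $x,y\in E$, where $L>0$. Prox-setup. $d:\Lambda\to\mathbb{R}$ is continuous and convex on $\Lambda$; $\Lambda^0\subseteq\Lambda$ is the set of points at which $d$ has a subgradient (relative to $\Lambda$); $\nabla d(\lambda)$, $\lambda\in\Lambda^0$, is a selection of subgradients that is continuous on $\Lambda^0$; and $d$ is $1$-strongly convex: $d(\eta)-d(\lambda)-\langle\nabla d(\lambda),\eta-\lambda\rangle\ge\frac12\|\eta-\lambda\|^2$ for all $\lambda\in\Lambda^0$, $\eta\in\Lambda$. The Bregman divergence is $V[\zeta](\lambda)=d(\lambda)-d(\zeta)-\langle\nabla d(\zeta),\lambda-\zeta\rangle$, $\lambda\in\Lambda$, $\zeta\in\Lambda^0$. Algorithm ASTM. Input: $\lambda_0\in\Lambda^0$ and $L_0>0$. Set $C_0=\alpha_0=0$, $\eta_0=\zeta_0=\lambda_0$. For $k=0,1,2,\dots$ (outer iterations; the outer loop is continued indefinitely, i.e. stopping is ignored): set $M_k=L_k/2$ and run the inner loop: repeat (i) set $M_k:=2M_k$ and let $\alpha_{k+1}$ be the largest root of $C_k+\alpha_{k+1}=M_k\alpha_{k+1}^2$,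 and put $C_{k+1}:=C_k+\alpha_{k+1}$; (ii) $\lambda_{k+1}=(\alpha_{k+1}\zeta_k+C_k\eta_k)/C_{k+1}$; (iii) $\zeta_{k+1}=\arg\min_{\lambda\in\Lambda}\{V[\zeta_k](\lambda)+\alpha_{k+1}(\varphi(\lambda_{k+1})+\langle\nabla\varphi(\lambda_{k+1}),\lambda-\lambda_{k+1}\rangle)\}$; (iv) $\eta_{k+1}=(\alpha_{k+1}\zeta_{k+1}+C_k\eta_k)/C_{k+1}$; until the check $\varphi(\eta_{k+1})\le\varphi(\lambda_{k+1})+\langle\nabla\varphi(\lambda_{k+1}),\eta_{k+1}-\lambda_{k+1}\rangle+\frac{M_k}{2}\|\eta_{k+1}-\lambda_{k+1}\|^2$ holds. The values at exit of the inner loop are kept; then set $L_{k+1}=M_k/2$ and pass to the next outer iteration. An oracle call is an evaluation of $\varphi$ and/or $\nabla\varphi$ at one point; each check in the inner loop uses two oracle calls (one at $\lambda_{k+1}$ and one at $\eta_{k+1}$).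
   Formalization: The bound on the number of oracle calls after iteration k is claimed only when L_0 ≤ 2^(k+1) L; otherwise it is false (e.g. φ=0, L=1, L_0=8, k=0: 2 calls, but the bound is −2). *)

theory Defs
  imports "HOL-Analysis.Analysis" "HOL-Library.While_Combinator"
begin

text \<open>
  The space \<open>E\<close> is a type \<open>'a\<close> of class \<open>real_normed_vector\<close> (finite-dimensionality is a separate
  hypothesis, so the norm is arbitrary and \<open>E = {0}\<close> is included). In finite dimension every linear
  functional is bounded, hence \<open>E\<^sup>*\<close> with the dual norm is the type \<open>'a \<Rightarrow>\<^sub>L real\<close> with its operator norm.
\<close>

definition subdifferential_on :: "'a::real_normed_vector set \<Rightarrow> ('a \<Rightarrow> real) \<Rightarrow> 'a \<Rightarrow> ('a \<Rightarrow>\<^sub>L real) set"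
  where "subdifferential_on S f x = {g. \<forall>y\<in>S. f y \<ge> f x + blinfun_apply g (y - x)}"

definition subdiff_domain :: "'a::real_normed_vector set \<Rightarrow> ('a \<Rightarrow> real) \<Rightarrow> 'a set"
  where "subdiff_domain S f = {x \<in> S. subdifferential_on S f x \<noteq> {}}"

definition prox_setup :: "'a::real_normed_vector set \<Rightarrow> ('a \<Rightarrow> real) \<Rightarrow> ('a \<Rightarrow> 'a \<Rightarrow>\<^sub>L real) \<Rightarrow> bool"
  where "prox_setup S d gd \<longleftrightarrow>
    continuous_on S d \<and> convex_on S d \<and>
    (\<forall>x\<in>subdiff_domain S d. gd x \<in> subdifferential_on S d x) \<and>
    continuous_on (subdiff_domain S d) gd \<and>
    (\<forall>x\<in>subdiff_domain S d. \<forall>y\<in>S.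
       d y - d x - blinfun_apply (gd x) (y - x) \<ge> 1/2 * (norm (y - x))\<^sup>2)"

text \<open>\<open>bregman d gd z x\<close> is $V[z](x)$: the prox-centre comes first.\<close>

definition bregman :: "('a::real_normed_vector \<Rightarrow> real) \<Rightarrow> ('a \<Rightarrow> 'a \<Rightarrow>\<^sub>L real) \<Rightarrow> 'a \<Rightarrow> 'a \<Rightarrow> real"
  where "bregman d gd z x = d x - d z - blinfun_apply (gd z) (x - z)"

definition linearization :: "('a::real_normed_vector \<Rightarrow> real) \<Rightarrow> ('a \<Rightarrow> 'a \<Rightarrow>\<^sub>L real) \<Rightarrow> 'a \<Rightarrow> 'a \<Rightarrow> real"
  where "linearization f gf x y = f x + blinfun_apply (gf x) (y - x)"

text \<open>
  After \<open>k\<close> completed outer iterations the fields hold $\lambda_k$, $\eta_k$, $\zeta_k$, $\alpha_k$,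
  $C_k$, $L_k$, the last trial value of \<open>M\<close>, and the number of oracle calls made so far.
\<close>

record 'a astm_state =
  lam_of :: 'a
  eta_of :: 'a
  zeta_of :: 'a
  alpha_of :: real
  C_of :: real
  L_of :: real
  M_of :: real
  calls_of :: nat

text \<open>
  \<open>astm_trial S f gf d gd s t\<close> is one pass through the body of the inner loop: \<open>s\<close> is the state at the
  start of the current outer iteration, \<open>t\<close> the state left by the previous pass, of which only
  \<open>M\<close>, \<open>L\<close> and the call counter are used. The two calls are those of the check that ends the pass.
\<close>

definition astm_trial :: "'a::real_normed_vector set \<Rightarrow> ('a \<Rightarrow> real) \<Rightarrow> ('a \<Rightarrow> 'a \<Rightarrow>\<^sub>L real) \<Rightarrow>
    ('a \<Rightarrow> real) \<Rightarrow> ('a \<Rightarrow> 'a \<Rightarrow>\<^sub>L real) \<Rightarrow> 'a astm_state \<Rightarrow> 'a astm_state \<Rightarrow> 'a astm_state"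
  where "astm_trial S f gf d gd s t =
    (let M = 2 * M_of t;
         a = (GREATEST a. C_of s + a = M * a\<^sup>2);
         C = C_of s + a;
         l = (1 / C) *\<^sub>R (a *\<^sub>R zeta_of s + C_of s *\<^sub>R eta_of s);
         z = arg_min_on (\<lambda>x. bregman d gd (zeta_of s) x + a * linearization f gf l x) S;
         e = (1 / C) *\<^sub>R (a *\<^sub>R z + C_of s *\<^sub>R eta_of s)
     in \<lparr>lam_of = l, eta_of = e, zeta_of = z, alpha_of = a, C_of = C,
         L_of = L_of t, M_of = M, calls_of = calls_of t + 2\<rparr>)"

definition astm_check :: "('a::real_normed_vector \<Rightarrow> real) \<Rightarrow> ('a \<Rightarrow> 'a \<Rightarrow>\<^sub>L real) \<Rightarrow> 'a astm_state \<Rightarrow> bool"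
  where "astm_check f gf t \<longleftrightarrow>
    f (eta_of t) \<le> linearization f gf (lam_of t) (eta_of t)
                   + M_of t / 2 * (norm (eta_of t - lam_of t))\<^sup>2"

text \<open>
  The first application of \<open>astm_trial\<close> below turns the while loop into a repeat-until loop. The
  result is \<open>None\<close> exactly when the check never succeeds, so that termination of the
  inner loops is not built into the definition.
\<close>

definition astm_step :: "'a::real_normed_vector set \<Rightarrow> ('a \<Rightarrow> real) \<Rightarrow> ('a \<Rightarrow> 'a \<Rightarrow>\<^sub>L real) \<Rightarrow>
    ('a \<Rightarrow> real) \<Rightarrow> ('a \<Rightarrow> 'a \<Rightarrow>\<^sub>L real) \<Rightarrow> 'a astm_state \<Rightarrow> 'a astm_state option"
  where "astm_step S f gf d gd s =
    map_option (\<lambda>t. t\<lparr>L_of := M_of t / 2\<rparr>)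
      (while_option (\<lambda>t. \<not> astm_check f gf t) (astm_trial S f gf d gd s)
        (astm_trial S f gf d gd s (s\<lparr>M_of := L_of s / 2\<rparr>)))"

text \<open>The initial value of \<open>M\<close> is never read: every outer iteration starts by resetting it.\<close>

definition astm_init :: "'a::real_normed_vector \<Rightarrow> real \<Rightarrow> 'a astm_state"
  where "astm_init x0 L0 =
    \<lparr>lam_of = x0, eta_of = x0, zeta_of = x0, alpha_of = 0, C_of = 0,
     L_of = L0, M_of = 0, calls_of = 0\<rparr>"

primrec astm :: "'a::real_normed_vector set \<Rightarrow> ('a \<Rightarrow> real) \<Rightarrow> ('a \<Rightarrow> 'a \<Rightarrow>\<^sub>L real) \<Rightarrow>
    ('a \<Rightarrow> real) \<Rightarrow> ('a \<Rightarrow> 'a \<Rightarrow>\<^sub>L real) \<Rightarrow> 'a \<Rightarrow> real \<Rightarrow> nat \<Rightarrow> 'a astm_state option"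
  where
    "astm S f gf d gd x0 L0 0 = Some (astm_init x0 L0)"
  | "astm S f gf d gd x0 L0 (Suc k) =
       Option.bind (astm S f gf d gd x0 L0 k) (astm_step S f gf d gd)"

end

(*
  The identity C_{k+1} = M_k alpha_{k+1}^2 together with
  eta_{k+1} - lambda_{k+1} = (alpha_{k+1} / C_{k+1}) (zeta_{k+1} - zeta_k) turns the quadratic term of the
  check into 1/2 |zeta_{k+1} - zeta_k|^2, which strong convexity bounds by V[zeta_k](zeta_{k+1}); the
  three-point inequality for the prox-step then gives, for every x in the feasible set,
    C_{k+1} phi(eta_{k+1}) + V[zeta_{k+1}](x)
      <= C_k phi(eta_k) + V[zeta_k](x) + alpha_{k+1} (linearization at lambda_{k+1})(x).
  The three-point inequality has to hold for the chosen subgradient of d at zeta_{k+1}, not just for the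
  one that the minimality of zeta_{k+1} produces; this is where continuity of the selection enters, through
  the density of the points where d has a subgradient.

  The check succeeds as soon as M_k >= L, so L_{k+1} <= max L (L_k / 2), and an outer iteration with j
  passes has L_{k+1} = 2^(j-2) L_k; summing the exponents counts the oracle calls.
*)

theory Submission
  imports Defs
begin

section \<open>Finite-dimensional normed spaces\<close>

text \<open>For \<open>u \<noteq> 0\<close> the right side is \<open>\<bar>u\<bar>\<close> times the
  distance from \<open>b\<close> to the point \<open>(- 1 / u) *\<^sub>R x\<close> of
  \<open>S\<close>, so \<open>\<delta>\<close> can be the distance of \<open>b\<close> from
  \<open>S\<close>. This controls the coordinate along \<open>b\<close> by the norm.\<close>

lemma dist_from_closed_subspace:
  fixes b :: "'a::real_normed_vector"
  assumes "closed S" "subspace S" "b \<notin> S"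
  obtains \<delta> where "\<delta> > 0" "\<And>x u. x \<in> S \<Longrightarrow> \<bar>u\<bar> * \<delta> \<le> norm (x + u *\<^sub>R b)"
proof -
  have "S \<noteq> {}" using subspace_0[OF assms(2)] by blast
  then have pos: "infdist b S > 0"
    using assms(1,3) by (simp add: infdist_pos_not_in_closed)
  have "\<bar>u\<bar> * infdist b S \<le> norm (x + u *\<^sub>R b)" if x: "x \<in> S" for x u
  proof (cases "u = 0")
    case False
    have "(- 1 / u) *\<^sub>R x \<in> S" using assms(2) x by (rule subspace_scale)
    then have "infdist b S \<le> norm (b - (- 1 / u) *\<^sub>R x)"
      by (metis infdist_le dist_norm)
    then have "\<bar>u\<bar> * infdist b S \<le> norm (u *\<^sub>R (b - (- 1 / u) *\<^sub>R x))"
      by (simp add: mult_left_mono)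
    also have "u *\<^sub>R (b - (- 1 / u) *\<^sub>R x) = x + u *\<^sub>R b"
      using False by (simp add: algebra_simps)
    finally show ?thesis .
  qed simp
  with pos show ?thesis by (rule that)
qed

text \<open>A convergent sequence is bounded, so it stays in one compact section, which then
  contains the limit.\<close>

lemma closed_of_compact_cball_sections:
  fixes S :: "'a::real_normed_vector set"
  assumes "\<And>r. compact (S \<inter> cball 0 r)"
  shows "closed S"
proof (unfold closed_sequential_limits, intro allI impI, elim conjE)
  fix x l assume x: "\<forall>n::nat. x n \<in> S" and l: "x \<longlonglongrightarrow> l"
  then have "Bseq x" by (simp add: convergentI convergent_imp_Bseq)
  then obtain K where "\<And>n. norm (x n) \<le> K" by (metis BseqE)
  then have "\<forall>n. x n \<in> S \<inter> cball 0 K" using x by simp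
  then show "l \<in> S"
    using compact_imp_closed[OF assms[of K]] l unfolding closed_sequential_limits by blast
qed

text \<open>Heine-Borel for an arbitrary norm, by induction on the spanning set. The radius is
  generalised: all radii together make \<open>span B\<close> closed, which bounds the new
  coordinate, and one larger radius covers the remaining part of the vector.\<close>

lemma compact_span_cball:
  fixes B :: "'a::real_normed_vector set"
  assumes "finite B"
  shows "compact (span B \<inter> cball 0 r)"
  using assms
proof (induction B arbitrary: r rule: finite_induct)
  case empty
  have "span {} \<inter> cball 0 r \<subseteq> {0::'a}" by simp
  then show ?case by (meson finite.emptyI finite_imp_compact finite_insert finite_subset)
next
  case (insert b B)
  show ?case
  proof (cases "b \<in> span B")
    case True
    then show ?thesis using insert.IH by (simp add: span_redundant)
  next
    case False
    have "closed (span B)"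
      using insert.IH by (rule closed_of_compact_cball_sections)
    then obtain \<delta> where \<delta>: "\<delta> > 0" "\<And>x u. x \<in> span B \<Longrightarrow> \<bar>u\<bar> * \<delta> \<le> norm (x + u *\<^sub>R b)"
      using dist_from_closed_subspace[OF _ subspace_span False] by metis
    \<comment> \<open>A vector of norm at most \<open>r\<close> has coordinate at most
      \<open>r / \<delta>\<close> along \<open>b\<close>; the triangle inequality then bounds its
      part in \<open>span B\<close>.\<close>
    define K where "K = {- (r / \<delta>)..r / \<delta>} \<times> (span B \<inter> cball 0 (r + r / \<delta> * norm b))"
    define T where "T = (\<lambda>p. snd p + fst p *\<^sub>R b)"
    have "compact K" unfolding K_def by (intro compact_Times insert.IH) simp
    moreover have "continuous_on K T" unfolding T_def by (intro continuous_intros)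
    ultimately have "compact (T ` K \<inter> cball 0 r)"
      by (intro compact_Int_closed compact_continuous_image) auto
    also have "T ` K \<inter> cball 0 r = span (insert b B) \<inter> cball 0 r"
    proof (intro set_eqI iffI)
      fix v assume "v \<in> T ` K \<inter> cball 0 r"
      then show "v \<in> span (insert b B) \<inter> cball 0 r"
        by (auto simp: T_def K_def span_breakdown_eq
            intro: exI[where P="\<lambda>k. _ - k *\<^sub>R b \<in> span B"])
           (metis add_diff_cancel_right')
    next
      fix v assume v: "v \<in> span (insert b B) \<inter> cball 0 r"
      then obtain u where u: "v - u *\<^sub>R b \<in> span B" by (auto simp: span_breakdown_eq)
      have "\<bar>u\<bar> * \<delta> \<le> norm v" using \<delta>(2)[OF u, of u] by simp
      also have "\<dots> \<le> r" using v by simp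
      finally have ub: "\<bar>u\<bar> \<le> r / \<delta>" using \<delta>(1) by (simp add: field_simps)
      have "norm (v - u *\<^sub>R b) \<le> norm v + norm (u *\<^sub>R b)" by (rule norm_triangle_ineq4)
      also have "\<dots> \<le> r + r / \<delta> * norm b"
        using v ub mult_right_mono[of "\<bar>u\<bar>" "r / \<delta>" "norm b"] by simp
      finally have "(u, v - u *\<^sub>R b) \<in> K" using u ub by (auto simp: K_def)
      moreover have "T (u, v - u *\<^sub>R b) = v" by (simp add: T_def)
      ultimately show "v \<in> T ` K \<inter> cball 0 r" using v by (metis Int_iff imageI)
    qed
    finally show ?thesis .
  qed
qed

lemma finite_dim_compact:
  fixes S :: "'a::real_normed_vector set"
  assumes "finite B" "span B = (UNIV::'a set)" "closed S" "bounded S"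
  shows "compact S"
proof -
  obtain r where "S \<subseteq> cball 0 r" using assms(4) by (auto simp: bounded_iff subset_iff)
  then have "S = (span B \<inter> cball 0 r) \<inter> S" using assms(2) by auto
  then show ?thesis
    using compact_Int_closed[OF compact_span_cball[OF assms(1)] assms(3)] by metis
qed

text \<open>Supplies a quadratic form that dominates the squared norm and expands exactly along
  lines; the norm itself need not be differentiable away from 0. Basis coordinates are bounded
  functionals, and Cauchy-Schwarz gives \<open>c\<close>.\<close>

lemma finite_dim_sum_squares_norm:
  fixes B :: "'a::real_normed_vector set"
  assumes "finite B" "span B = UNIV"
  obtains I :: "'a set" and p :: "'a \<Rightarrow> 'a \<Rightarrow>\<^sub>L real" and c where
    "finite I" "c > 0" "\<And>v. (norm v)\<^sup>2 \<le> c * (\<Sum>i\<in>I. (p i v)\<^sup>2)"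
proof -
  obtain I where I: "I \<subseteq> B" "independent I" "span I = UNIV"
    by (metis assms(2) maximal_independent_subset span_mono span_span subset_antisym top_greatest)
  have fin: "finite I" using I(1) assms(1) finite_subset by blast
  \<comment> \<open>\<open>Blinfun\<close> takes the intended values only on bounded linear maps;
    \<open>bl\<close> provides this for \<open>i \<in> I\<close>.\<close>
  define p where "p = (\<lambda>i. Blinfun (\<lambda>v. representation I v i))"
  have sum_rep: "(\<Sum>i\<in>I. representation I v i *\<^sub>R i) = v" for v
    using sum_representation_eq[OF I(2) _ fin, of v] I(3) by simp
  have bl: "bounded_linear (\<lambda>v. representation I v i)" if i: "i \<in> I" for i
  proof -
    have "closed (span (I - {i}))"
      using compact_span_cball[of "I - {i}"] fin by (intro closed_of_compact_cball_sections) auto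
    moreover have "i \<notin> span (I - {i})" using I(2) i by (auto simp: dependent_def)
    ultimately obtain \<delta> where \<delta>: "\<delta> > 0"
      "\<And>x u. x \<in> span (I - {i}) \<Longrightarrow> \<bar>u\<bar> * \<delta> \<le> norm (x + u *\<^sub>R i)"
      using dist_from_closed_subspace[OF _ subspace_span] by metis
    have "\<bar>representation I v i\<bar> \<le> norm v * (1 / \<delta>)" for v
    proof -
      have "(\<Sum>j\<in>I - {i}. representation I v j *\<^sub>R j) \<in> span (I - {i})"
        by (intro span_sum span_scale span_base)
      from \<delta>(2)[OF this, of "representation I v i"]
      have "\<bar>representation I v i\<bar> * \<delta> \<le> norm v"
        using sum.remove[OF fin i, of "\<lambda>j. representation I v j *\<^sub>R j"] sum_rep[of v]
        by (simp add: add.commute)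
      then show ?thesis using \<delta>(1) by (simp add: field_simps)
    qed
    then show ?thesis
      by (intro bounded_linear_intro[where K="1 / \<delta>"])
         (simp_all add: representation_add[OF I(2)] representation_scale[OF I(2)] I(3))
  qed
  \<comment> \<open>The \<open>+ 1\<close> keeps \<open>c\<close> positive when the basis is empty,
    that is, when the space is {0}.\<close>
  define c where "c = (\<Sum>i\<in>I. (norm i)\<^sup>2) + 1"
  have "c > 0" by (simp add: c_def add_nonneg_pos sum_nonneg)
  moreover have "(norm v)\<^sup>2 \<le> c * (\<Sum>i\<in>I. (p i v)\<^sup>2)" for v
  proof -
    let ?r = "representation I v"
    have "norm v \<le> (\<Sum>i\<in>I. \<bar>?r i\<bar> * norm i)"
      using norm_sum[of "\<lambda>i. ?r i *\<^sub>R i" I] sum_rep[of v] by simp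
    then have "(norm v)\<^sup>2 \<le> (\<Sum>i\<in>I. \<bar>?r i\<bar> * norm i)\<^sup>2" by (intro power_mono) auto
    also have "\<dots> \<le> (\<Sum>i\<in>I. \<bar>?r i\<bar>\<^sup>2) * (\<Sum>i\<in>I. (norm i)\<^sup>2)"
      by (rule Cauchy_Schwarz_ineq_sum)
    also have "\<dots> \<le> c * (\<Sum>i\<in>I. (?r i)\<^sup>2)"
      by (simp add: c_def distrib_right mult.commute sum_nonneg)
    also have "(\<Sum>i\<in>I. (?r i)\<^sup>2) = (\<Sum>i\<in>I. (p i v)\<^sup>2)"
      by (rule sum.cong) (simp_all add: p_def bounded_linear_Blinfun_apply bl)
    finally show ?thesis .
  qed
  ultimately show ?thesis using fin that by blast
qed

section \<open>Smooth convex functions\<close>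

lemma has_real_derivative_along_line:
  assumes "\<And>x. (f has_derivative blinfun_apply (gf x)) (at x)"
  shows "((\<lambda>t. f (x + t *\<^sub>R v)) has_real_derivative gf (x + t *\<^sub>R v) v) (at t)"
proof -
  have "((\<lambda>t. x + t *\<^sub>R v) has_derivative (\<lambda>s. s *\<^sub>R v)) (at t)"
    by (auto intro!: derivative_eq_intros)
  from has_derivative_compose[OF this assms] show ?thesis
    by (simp add: has_field_derivative_def blinfun.scaleR_right mult_commute_abs)
qed

text \<open>Convexity bounds every difference quotient along the segment by
  \<open>f y - f x\<close>, and the derivative is their limit from the right.\<close>

lemma convex_tangent_bound:
  assumes "convex_on UNIV f" and deriv: "\<And>x. (f has_derivative blinfun_apply (gf x)) (at x)"
  shows "linearization f gf x y \<le> f y"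
proof -
  define h where "h = (\<lambda>t::real. f (x + t *\<^sub>R (y - x)))"
  have der: "(h has_real_derivative gf x (y - x)) (at 0)"
    using has_real_derivative_along_line[OF deriv, of x "y - x" 0] by (simp add: h_def)
  have "((\<lambda>t. (h t - h 0) / t) \<longlongrightarrow> gf x (y - x)) (at_right 0)"
    using der unfolding has_field_derivative_iff by (simp add: filterlim_at_split)
  moreover have "\<forall>\<^sub>F t in at_right 0. (h t - h 0) / t \<le> f y - f x"
    using eventually_at_right_less[of 0] eventually_at_right_real[of 0 1]
  proof (rule eventually_elim2)
    fix t :: real assume t: "0 < t" "t \<in> {0<..<1}"
    have "h t = f ((1 - t) *\<^sub>R x + t *\<^sub>R y)" by (simp add: h_def algebra_simps)
    also have "\<dots> \<le> (1 - t) * f x + t * f y"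
      using t by (intro convex_onD[OF assms(1)]) auto
    finally have "h t - h 0 \<le> t * (f y - f x)" by (simp add: h_def algebra_simps)
    then show "(h t - h 0) / t \<le> f y - f x" using t by (simp add: field_simps)
  qed simp
  ultimately have "gf x (y - x) \<le> f y - f x"
    by (rule tendsto_upperbound) simp
  then show ?thesis by (simp add: linearization_def)
qed

text \<open>Subtracting the quadratic model along the segment leaves a function \<open>h\<close>
  whose derivative is nonpositive on [0, 1] by the Lipschitz bound; compare its values at 0 and
  1.\<close>

lemma lipschitz_gradient_upper_bound:
  assumes deriv: "\<And>x. (f has_derivative blinfun_apply (gf x)) (at x)"
    and lip: "L-lipschitz_on UNIV gf"
  shows "f y \<le> linearization f gf x y + L / 2 * (norm (y - x))\<^sup>2"
proof -
  define v where "v = y - x"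
  define h where "h = (\<lambda>t::real. f (x + t *\<^sub>R v) - t * gf x v - L / 2 * t\<^sup>2 * (norm v)\<^sup>2)"
  have der: "(h has_real_derivative gf (x + t *\<^sub>R v) v - gf x v - L * t * (norm v)\<^sup>2) (at t)" for t
    unfolding h_def
    by (rule derivative_eq_intros has_real_derivative_along_line[OF deriv] refl | simp)+
  have neg: "gf (x + t *\<^sub>R v) v - gf x v - L * t * (norm v)\<^sup>2 \<le> 0" if "0 \<le> t" for t
  proof -
    have "(gf (x + t *\<^sub>R v) - gf x) v \<le> norm (gf (x + t *\<^sub>R v) - gf x) * norm v"
      using norm_blinfun[of "gf (x + t *\<^sub>R v) - gf x" v] by simp
    also have "\<dots> \<le> (L * norm (t *\<^sub>R v)) * norm v"
      using lipschitz_onD[OF lip, of "x + t *\<^sub>R v" x]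
      by (intro mult_right_mono) (auto simp: dist_norm)
    finally show ?thesis using that by (simp add: blinfun.diff_left power2_eq_square)
  qed
  then have "h 1 \<le> h 0"
    by (intro DERIV_nonpos_imp_nonincreasing[of 0 1]) (simp, meson der neg)
  then show ?thesis by (simp add: h_def v_def linearization_def)
qed

section \<open>Prox-functions\<close>

locale prox_domain =
  fixes B S :: "'a::real_normed_vector set"
    and d :: "'a \<Rightarrow> real" and gd :: "'a \<Rightarrow> 'a \<Rightarrow>\<^sub>L real"
  assumes finite_dim: "finite B" "span B = UNIV"
    and closed: "closed S" and convex: "convex S"
    and prox: "prox_setup S d gd"
    and domain_nonempty: "subdiff_domain S d \<noteq> {}"
begin

lemma domain_subset: "x \<in> subdiff_domain S d \<Longrightarrow> x \<in> S"
  by (simp add: subdiff_domain_def)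

lemma domainI: "x \<in> S \<Longrightarrow> g \<in> subdifferential_on S d x \<Longrightarrow> x \<in> subdiff_domain S d"
  by (auto simp: subdiff_domain_def)

lemma bregman_lower_bound:
  assumes "z \<in> subdiff_domain S d" "x \<in> S"
  shows "1/2 * (norm (x - z))\<^sup>2 \<le> bregman d gd z x"
  using assms prox by (simp add: prox_setup_def bregman_def)

lemma continuous_on_d: "continuous_on S d"
  using prox by (simp add: prox_setup_def)

text \<open>The quadratic term beats the linear one, so outside a ball around \<open>z\<close> the
  values exceed \<open>h z\<close>; inside it compactness gives the minimum.\<close>

lemma attains_min_quadratic_growth:
  assumes h: "continuous_on S h" and z: "z \<in> S"
    and growth: "\<And>x. x \<in> S \<Longrightarrow> A + blinfun_apply p (x - z) + 1/2 * (norm (x - z))\<^sup>2 \<le> h x"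
  obtains w where "w \<in> S" "\<And>x. x \<in> S \<Longrightarrow> h w \<le> h x"
proof -
  \<comment> \<open>Beyond radius \<open>R\<close> the slack \<open>r / 2 - norm p\<close> is at
    least 1, so the lower model is at least \<open>A + r\<close>, and \<open>r\<close> exceeds
    \<open>\<bar>h z - A\<bar>\<close>.\<close>
  define R where "R = 2 * norm p + 2 + \<bar>h z - A\<bar>"
  have outside: "h z < h x" if x: "x \<in> S" "norm (x - z) > R" for x
  proof -
    define r where "r = norm (x - z)"
    have r: "r > 0" "r / 2 - norm p \<ge> 1" "r > \<bar>h z - A\<bar>"
      using x(2) norm_ge_zero[of p] unfolding R_def r_def by linarith+
    have "- (norm p * r) \<le> p (x - z)"
      using norm_blinfun[of p "x - z"] by (simp add: r_def)
    moreover have "r * 1 \<le> r * (r / 2 - norm p)" using r by (intro mult_left_mono) auto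
    ultimately have "A + r \<le> A + p (x - z) + 1/2 * r\<^sup>2"
      by (simp add: power2_eq_square algebra_simps)
    then show ?thesis using growth[OF x(1)] r by (simp add: r_def)
  qed
  have "compact (S \<inter> cball z R)"
    using closed by (intro finite_dim_compact[OF finite_dim]) auto
  moreover have zR: "z \<in> S \<inter> cball z R" using z by (simp add: R_def)
  moreover have "continuous_on (S \<inter> cball z R) h" using h by (rule continuous_on_subset) auto
  ultimately obtain w where w: "w \<in> S \<inter> cball z R" "\<And>x. x \<in> S \<inter> cball z R \<Longrightarrow> h w \<le> h x"
    using continuous_attains_inf[of "S \<inter> cball z R" h] by blast
  have "h w \<le> h x" if "x \<in> S" for x
  proof (cases "norm (x - z) > R")
    case True
    then show ?thesis using outside[OF that] w(2)[OF zR] by simp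
  next
    case False
    then show ?thesis using w(2) that by (simp add: dist_norm norm_minus_commute)
  qed
  with w(1) show ?thesis using that by blast
qed

lemma d_bounded_below: obtains m where "\<And>x. x \<in> S \<Longrightarrow> m \<le> d x"
proof -
  obtain z where z: "z \<in> subdiff_domain S d" using domain_nonempty by blast
  \<comment> \<open>The constant comes from minimising
    \<open>r\<^sup>2 / 2 - norm (gd z) * r\<close> over \<open>r\<close>.\<close>
  have "d z - (norm (gd z))\<^sup>2 / 2 \<le> d x" if x: "x \<in> S" for x
  proof -
    have "- (norm (gd z) * norm (x - z)) \<le> gd z (x - z)"
      using norm_blinfun[of "gd z" "x - z"] by simp
    moreover have "0 \<le> (norm (gd z) - norm (x - z))\<^sup>2" by simp
    ultimately show ?thesis
      using bregman_lower_bound[OF z x] by (simp add: bregman_def power2_eq_square algebra_simps)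
  qed
  then show ?thesis by (rule that)
qed

text \<open>
  Minimising \<open>d\<close> plus a large multiple of a smooth quadratic centred at \<open>y\<close> yields a point near \<open>y\<close>
  at which the first-order condition supplies a subgradient of \<open>d\<close>.
\<close>

lemma subdiff_domain_dense:
  assumes y: "y \<in> S" and "e > 0"
  obtains w where "w \<in> subdiff_domain S d" "norm (w - y) < e"
proof -
  obtain I :: "'a set" and p :: "'a \<Rightarrow> 'a \<Rightarrow>\<^sub>L real" and c where
    p: "finite I" "c > 0" "\<And>v. (norm v)\<^sup>2 \<le> c * (\<Sum>i\<in>I. (p i v)\<^sup>2)"
    using finite_dim_sum_squares_norm[OF finite_dim] by metis
  obtain m where m: "\<And>x. x \<in> S \<Longrightarrow> m \<le> d x" using d_bounded_below by blast
  define q where "q v = (\<Sum>i\<in>I. (p i v)\<^sup>2)" for v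
  \<comment> \<open>Minimality will give \<open>K * q (z - y) \<le> d y - m\<close>; this
    \<open>K\<close> turns that into \<open>c * q (z - y) < e\<^sup>2\<close>. The
    \<open>+ 1\<close> makes \<open>K\<close> positive and the inequality strict.\<close>
  define K where "K = (d y - m + 1) * c / e\<^sup>2"
  define h where "h x = d x + K * q (x - y)" for x
  have K: "K > 0" using m[OF y] p(2) \<open>e > 0\<close> by (simp add: K_def)
  have q_expand: "q (u + t *\<^sub>R v) = q u + 2 * t * (\<Sum>i\<in>I. p i u * p i v) + t\<^sup>2 * q v" for u v t
  proof -
    have "q (u + t *\<^sub>R v) = (\<Sum>i\<in>I. (p i u)\<^sup>2 + 2 * t * (p i u * p i v) + t\<^sup>2 * (p i v)\<^sup>2)"
      unfolding q_def by (rule sum.cong)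
        (simp_all add: blinfun.add_right blinfun.scaleR_right power2_eq_square algebra_simps)
    then show ?thesis by (simp add: q_def sum.distrib sum_distrib_left)
  qed
  have q_nonneg: "0 \<le> q v" for v by (simp add: q_def sum_nonneg)
  obtain z0 where z0: "z0 \<in> subdiff_domain S d" using domain_nonempty by blast
  have "continuous_on S h" unfolding h_def q_def
    by (intro continuous_intros continuous_on_d)
  moreover have "d z0 + gd z0 (x - z0) + 1/2 * (norm (x - z0))\<^sup>2 \<le> h x" if "x \<in> S" for x
    using bregman_lower_bound[OF z0 that] K q_nonneg[of "x - y"]
    by (simp add: h_def bregman_def add_increasing2)
  ultimately obtain z where z: "z \<in> S" "\<And>x. x \<in> S \<Longrightarrow> h z \<le> h x"
    using attains_min_quadratic_growth[OF _ domain_subset[OF z0]] by metis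
  have "K * q (z - y) \<le> d y - m"
    using z(2)[OF y] m[OF z(1)] by (simp add: h_def q_def)
  then have "c * (K * q (z - y)) < c * (d y - m + 1)"
    using p(2) by simp
  also have "\<dots> = K * e\<^sup>2" using \<open>e > 0\<close> by (simp add: K_def)
  finally have "K * (c * q (z - y)) < K * e\<^sup>2" by (simp add: mult.left_commute)
  then have "c * q (z - y) < e\<^sup>2" using K by simp
  then have "(norm (z - y))\<^sup>2 < e\<^sup>2" using p(3)[of "z - y"] by (simp add: q_def)
  then have near: "norm (z - y) < e" using \<open>e > 0\<close> by (simp add: power2_less_imp_less)
  \<comment> \<open>Minus the gradient of the penalty \<open>K * q (x - y)\<close> at the minimiser
    \<open>z\<close>.\<close>
  define g where "g = - ((2 * K) *\<^sub>R (\<Sum>i\<in>I. p i (z - y) *\<^sub>R p i))"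
  have "d z + g (x - z) \<le> d x" if x: "x \<in> S" for x
  proof -
    define b where "b = (\<Sum>i\<in>I. p i (z - y) * p i (x - z))"
    \<comment> \<open>Compare \<open>z\<close> with the point at parameter \<open>t\<close> towards
      \<open>x\<close>: convexity handles \<open>d\<close>, the penalty expands exactly, and
      division by \<open>t\<close> leaves an error that vanishes with \<open>t\<close>.\<close>
    have "0 \<le> d x - d z + 2 * K * b + t * (K * q (x - z))" if t: "0 < t" "t < 1" for t
    proof -
      have eq: "z + t *\<^sub>R (x - z) = (1 - t) *\<^sub>R z + t *\<^sub>R x" by (simp add: algebra_simps)
      have inS: "z + t *\<^sub>R (x - z) \<in> S"
        using convexD[OF convex z(1) x, of "1 - t" t] t by (simp add: eq)
      have "d (z + t *\<^sub>R (x - z)) \<le> (1 - t) * d z + t * d x"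
        unfolding eq using prox z(1) x t by (intro convex_onD[where A=S]) (auto simp: prox_setup_def)
      moreover have "h z \<le> h (z + t *\<^sub>R (x - z))" using z(2)[OF inS] .
      moreover have "z + t *\<^sub>R (x - z) - y = z - y + t *\<^sub>R (x - z)" by simp
      ultimately have "0 \<le> t * (d x - d z + 2 * K * b + t * (K * q (x - z)))"
        unfolding h_def by (simp only: q_expand b_def[symmetric])
          (simp add: algebra_simps power2_eq_square)
      then show ?thesis using t by (simp add: zero_le_mult_iff)
    qed
    then have "\<forall>\<^sub>F t in at_right 0. 0 \<le> d x - d z + 2 * K * b + t * (K * q (x - z))"
      using eventually_at_right_real[of 0 1] by (auto elim!: eventually_mono)
    moreover have "((\<lambda>t. d x - d z + 2 * K * b + t * (K * q (x - z))) \<longlongrightarrow>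
        d x - d z + 2 * K * b + 0 * (K * q (x - z))) (at_right 0)"
      by (intro tendsto_intros)
    ultimately have "0 \<le> d x - d z + 2 * K * b + 0 * (K * q (x - z))"
      by (intro tendsto_lowerbound) auto
    moreover have "g (x - z) = - (2 * K * b)"
      by (simp add: g_def b_def blinfun.minus_left blinfun.scaleR_left blinfun.sum_left)
    ultimately show ?thesis by simp
  qed
  then have "g \<in> subdifferential_on S d z" by (simp add: subdifferential_on_def)
  then show ?thesis using domainI[OF z(1)] near that by blast
qed

text \<open>
  A continuous selection of subgradients is the largest one in every feasible direction: compare \<open>p\<close>
  with the subgradients at nearby points of \<open>subdiff_domain S d\<close> approaching \<open>z\<close> along \<open>x - z\<close>.
\<close>

lemma selection_dominates_subgradient:
  assumes z: "z \<in> subdiff_domain S d" and p: "p \<in> subdifferential_on S d z" and x: "x \<in> S"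
  shows "blinfun_apply p (x - z) \<le> gd z (x - z)"
proof -
  define t where "t n = inverse (real (Suc n))" for n
  have t: "0 < t n" "t n \<le> 1" for n by (auto simp: t_def field_simps)
  have t_lim: "t \<longlonglongrightarrow> 0" unfolding t_def by (rule LIMSEQ_inverse_real_of_nat)
  \<comment> \<open>The tolerance is squared so that the rescaled directions \<open>v n\<close>
    still converge to \<open>x - z\<close> after division by \<open>t n\<close>.\<close>
  have "\<exists>w. w \<in> subdiff_domain S d \<and> norm (w - (z + t n *\<^sub>R (x - z))) < (t n)\<^sup>2" for n
  proof -
    have eq: "z + t n *\<^sub>R (x - z) = (1 - t n) *\<^sub>R z + t n *\<^sub>R x" by (simp add: algebra_simps)
    have "z + t n *\<^sub>R (x - z) \<in> S"
      using convexD[OF convex domain_subset[OF z] x, of "1 - t n" "t n"] t[of n] by (simp add: eq)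
    then show ?thesis using subdiff_domain_dense[of "z + t n *\<^sub>R (x - z)" "(t n)\<^sup>2"] t[of n] by auto
  qed
  then obtain w where w: "\<And>n. w n \<in> subdiff_domain S d"
    "\<And>n. norm (w n - (z + t n *\<^sub>R (x - z))) < (t n)\<^sup>2" by metis
  define v where "v n = (1 / t n) *\<^sub>R (w n - z)" for n
  have "norm (v n - (x - z)) \<le> t n" for n
  proof -
    have "v n - (x - z) = (1 / t n) *\<^sub>R (w n - (z + t n *\<^sub>R (x - z)))"
      using t(1)[of n] by (simp add: v_def algebra_simps)
    then have "norm (v n - (x - z)) = norm (w n - (z + t n *\<^sub>R (x - z))) / t n"
      using t(1)[of n] by simp
    also have "\<dots> \<le> t n"
      using w(2)[of n] t(1)[of n] by (simp add: power2_eq_square field_simps)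
    finally show ?thesis .
  qed
  then have v_lim: "v \<longlonglongrightarrow> x - z"
    by (intro LIM_zero_cancel[OF Lim_null_comparison[OF _ t_lim]]) auto
  have "(\<lambda>n. z + t n *\<^sub>R v n) \<longlonglongrightarrow> z + 0 *\<^sub>R (x - z)"
    by (intro tendsto_intros t_lim v_lim)
  moreover have "z + t n *\<^sub>R v n = w n" for n using t(1)[of n] by (simp add: v_def)
  ultimately have "w \<longlonglongrightarrow> z" by simp
  then have "(\<lambda>n. gd (w n)) \<longlonglongrightarrow> gd z"
    using prox z w(1) by (intro continuous_on_tendsto_compose[of "subdiff_domain S d" gd])
      (auto simp: prox_setup_def)
  then have "(\<lambda>n. (gd (w n) - p) (v n)) \<longlonglongrightarrow> (gd z - p) (x - z)"
    by (intro blinfun.tendsto tendsto_intros v_lim)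
  \<comment> \<open>Monotonicity of the subdifferential: add the subgradient inequalities at
    \<open>w n\<close> and at \<open>z\<close>.\<close>
  moreover have "0 \<le> (gd (w n) - p) (v n)" for n
  proof -
    have "d z \<ge> d (w n) + gd (w n) (z - w n)"
      using prox w(1)[of n] domain_subset[OF z] by (auto simp: prox_setup_def subdifferential_on_def)
    moreover have "d (w n) \<ge> d z + p (w n - z)"
      using p domain_subset[OF w(1)] by (auto simp: subdifferential_on_def)
    ultimately have "0 \<le> (gd (w n) - p) (w n - z)"
      by (simp add: blinfun.diff_left blinfun.diff_right)
    then show ?thesis using t(1)[of n] by (simp add: v_def blinfun.scaleR_right)
  qed
  ultimately have "0 \<le> (gd z - p) (x - z)" by (intro LIMSEQ_le_const) auto
  then show ?thesis by (simp add: blinfun.diff_left)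
qed

text \<open>Strong convexity at \<open>\<zeta>\<close> supplies the quadratic growth. Used for the
  prox step and again for the minimum in the final estimate.\<close>

lemma bregman_plus_affine_attains_min:
  assumes \<zeta>: "\<zeta> \<in> subdiff_domain S d" and l: "\<And>x. l x = A + blinfun_apply p (x - \<zeta>)"
  obtains w where "is_arg_min (\<lambda>x. l x + bregman d gd \<zeta> x) (\<lambda>x. x \<in> S) w"
proof -
  define h where "h = (\<lambda>x. l x + bregman d gd \<zeta> x)"
  have "continuous_on S h" unfolding h_def l bregman_def
    by (intro continuous_intros continuous_on_d)
  moreover have "A + p (x - \<zeta>) + 1/2 * (norm (x - \<zeta>))\<^sup>2 \<le> h x" if "x \<in> S" for x
    using bregman_lower_bound[OF \<zeta> that] by (simp add: h_def l)
  ultimately obtain w where "w \<in> S" "\<And>x. x \<in> S \<Longrightarrow> h w \<le> h x"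
    using attains_min_quadratic_growth[OF _ domain_subset[OF \<zeta>]] by metis
  then have "is_arg_min h (\<lambda>x. x \<in> S) w" by (auto simp: is_arg_min_linorder)
  then show ?thesis unfolding h_def by (rule that)
qed

text \<open>The objective differs from its value at \<open>z\<close> by exactly
  \<open>d x - d z - p (x - z)\<close> with \<open>p = gd \<zeta> - a *\<^sub>R gf l\<close>, so
  minimality makes \<open>p\<close> a subgradient at \<open>z\<close>. Replacing \<open>p\<close> by
  the dominating \<open>gd z\<close> only shrinks this difference.\<close>

lemma prox_step:
  assumes \<zeta>: "\<zeta> \<in> subdiff_domain S d"
    and z: "z = arg_min_on (\<lambda>x. bregman d gd \<zeta> x + a * linearization f gf l x) S"
  shows "z \<in> subdiff_domain S d"
    and "x \<in> S \<Longrightarrow> bregman d gd \<zeta> z + a * linearization f gf l z + bregman d gd z x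
           \<le> bregman d gd \<zeta> x + a * linearization f gf l x"
proof -
  define h where "h = (\<lambda>x. bregman d gd \<zeta> x + a * linearization f gf l x)"
  have "a * linearization f gf l x = a * linearization f gf l \<zeta> + (a *\<^sub>R gf l) (x - \<zeta>)" for x
    by (simp add: linearization_def blinfun.scaleR_left blinfun.diff_right algebra_simps)
  \<comment> \<open>\<open>arg_min_on\<close> is a choice operator: it yields a minimiser only once
    one is known to exist.\<close>
  then obtain w
    where "is_arg_min (\<lambda>x. a * linearization f gf l x + bregman d gd \<zeta> x) (\<lambda>x. x \<in> S) w"
    by (rule bregman_plus_affine_attains_min[OF \<zeta>])
  moreover have "(\<lambda>x. a * linearization f gf l x + bregman d gd \<zeta> x) = h"
    unfolding h_def by (intro ext add.commute)
  ultimately have "is_arg_min h (\<lambda>x. x \<in> S) w" by simp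
  then have "is_arg_min h (\<lambda>x. x \<in> S) z"
    unfolding z h_def arg_min_on_def arg_min_def by (rule someI)
  then have zS: "z \<in> S" and zmin: "\<And>x. x \<in> S \<Longrightarrow> h z \<le> h x"
    by (auto simp: is_arg_min_linorder)
  define p where "p = gd \<zeta> - a *\<^sub>R gf l"
  have h_diff: "h x - h z = d x - d z - p (x - z)" for x
    by (simp add: h_def p_def bregman_def linearization_def blinfun.diff_left blinfun.scaleR_left
        blinfun.diff_right algebra_simps)
  have "d z + p (y - z) \<le> d y" if "y \<in> S" for y
    using zmin[OF that] h_diff[of y] by linarith
  then have sub: "p \<in> subdifferential_on S d z" by (simp add: subdifferential_on_def)
  then show zdom: "z \<in> subdiff_domain S d" by (rule domainI[OF zS])
  show "bregman d gd \<zeta> z + a * linearization f gf l z + bregman d gd z x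
           \<le> bregman d gd \<zeta> x + a * linearization f gf l x" if x: "x \<in> S"
    using selection_dominates_subgradient[OF zdom sub x] h_diff[of x]
    by (simp add: h_def bregman_def)
qed

end

section \<open>The adaptive similar triangles method\<close>

text \<open>Completing the square gives \<open>(2 * M * a - 1)\<^sup>2 = 1 + 4 * C * M\<close> for
  every root \<open>a\<close>, hence the explicit largest root \<open>r\<close>. For
  \<open>C = 0\<close>, as in the first outer iteration, this selects \<open>1 / M\<close> rather
  than 0.\<close>

lemma greatest_root:
  fixes C M :: real
  assumes "C \<ge> 0" "M > 0"
  shows "(GREATEST a. C + a = M * a\<^sup>2) > 0"
    and "C + (GREATEST a. C + a = M * a\<^sup>2) = M * (GREATEST a. C + a = M * a\<^sup>2)\<^sup>2"
proof -
  define s where "s = sqrt (1 + 4 * C * M)"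
  define r where "r = (1 + s) / (2 * M)"
  have s: "s\<^sup>2 = 1 + 4 * C * M" "s \<ge> 0" using assms by (auto simp: s_def)
  have "M * r\<^sup>2 = (1 + 2 * s + s\<^sup>2) / (4 * M)"
    using assms by (simp add: r_def power2_eq_square field_simps)
  also have "\<dots> = C + r" using assms by (simp add: s(1) r_def field_simps)
  finally have root: "C + r = M * r\<^sup>2" by simp
  have "a \<le> r" if a: "C + a = M * a\<^sup>2" for a
  proof -
    have "(2 * M * a - 1)\<^sup>2 = 4 * M * (M * a\<^sup>2) - 4 * M * a + 1"
      by (simp add: power2_eq_square algebra_simps)
    also have "\<dots> = 1 + 4 * C * M" by (simp add: a[symmetric] algebra_simps)
    finally have "2 * M * a - 1 \<le> s" unfolding s_def by (intro real_le_rsqrt) simp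
    then show ?thesis using assms by (simp add: r_def field_simps)
  qed
  with root have "(GREATEST a. C + a = M * a\<^sup>2) = r" by (intro Greatest_equality) auto
  moreover have "r > 0" using s assms by (simp add: r_def)
  ultimately show "(GREATEST a. C + a = M * a\<^sup>2) > 0"
    and "C + (GREATEST a. C + a = M * a\<^sup>2) = M * (GREATEST a. C + a = M * a\<^sup>2)\<^sup>2"
    using root by simp_all
qed

lemma astm_trial_funpow:
  "M_of ((astm_trial S f gf d gd s ^^ n) u) = 2 ^ n * M_of u"
  "calls_of ((astm_trial S f gf d gd s ^^ n) u) = calls_of u + 2 * n"
  by (induction n) (simp_all add: astm_trial_def Let_def)

locale astm_setting = prox_domain B S d gd
  for B S :: "'a::real_normed_vector set" and d and gd +
  fixes f :: "'a \<Rightarrow> real" and gf :: "'a \<Rightarrow> 'a \<Rightarrow>\<^sub>L real" and L :: real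
  assumes convex_f: "convex_on UNIV f"
    and deriv_f: "\<And>x. (f has_derivative blinfun_apply (gf x)) (at x)"
    and L_pos: "L > 0" and lipschitz: "L-lipschitz_on UNIV gf"
begin

lemma astm_check_if_large: "L \<le> M_of t \<Longrightarrow> astm_check f gf t"
  unfolding astm_check_def
  using lipschitz_gradient_upper_bound[OF deriv_f lipschitz, of "eta_of t" "lam_of t"]
  by (elim order_trans) (auto intro!: mult_right_mono)

text \<open>Only the accepted pass is concerned: every trial restarts from \<open>s\<close>, so
  rejected passes leave nothing behind except the doubled \<open>M\<close> and the counter.\<close>

lemma astm_trial_energy:
  assumes \<zeta>: "zeta_of s \<in> subdiff_domain S d" and C: "0 \<le> C_of s" and M: "0 < M_of u"
    and t: "t = astm_trial S f gf d gd s u" and check: "astm_check f gf t"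
  shows "zeta_of t \<in> subdiff_domain S d" "0 \<le> C_of t"
    and "x \<in> S \<Longrightarrow> C_of t * f (eta_of t) + bregman d gd (zeta_of t) x
      \<le> C_of s * f (eta_of s) + bregman d gd (zeta_of s) x
        + alpha_of t * linearization f gf (lam_of t) x"
proof -
  define a where "a = alpha_of t"
  define l where "l = lam_of t"
  have a_greatest: "a = (GREATEST a. C_of s + a = M_of t * a\<^sup>2)"
    and Ct: "C_of t = C_of s + a"
    and lam: "l = (1 / C_of t) *\<^sub>R (a *\<^sub>R zeta_of s + C_of s *\<^sub>R eta_of s)"
    and zeta: "zeta_of t = arg_min_on (\<lambda>x. bregman d gd (zeta_of s) x + a * linearization f gf l x) S"
    and eta: "eta_of t = (1 / C_of t) *\<^sub>R (a *\<^sub>R zeta_of t + C_of s *\<^sub>R eta_of s)"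
    and Mt: "M_of t = 2 * M_of u"
    by (simp_all add: t a_def l_def astm_trial_def Let_def)
  have a: "a > 0" "C_of t = M_of t * a\<^sup>2"
    using greatest_root[of "C_of s" "M_of t"] C M Mt Ct unfolding a_greatest by auto
  show "zeta_of t \<in> subdiff_domain S d" by (rule prox_step(1)[OF \<zeta> zeta])
  show "0 \<le> C_of t" using Ct C a by simp
  have C_pos: "C_of t > 0" using Ct C a by simp
  show "C_of t * f (eta_of t) + bregman d gd (zeta_of t) x
      \<le> C_of s * f (eta_of s) + bregman d gd (zeta_of s) x
        + alpha_of t * linearization f gf (lam_of t) x" if x: "x \<in> S"
  proof -
    define lin where "lin = linearization f gf l"
    \<comment> \<open>Both points are averages with the same weights and share the term in
      \<open>eta_of s\<close>, which cancels.\<close>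
    have "eta_of t - l = (a / C_of t) *\<^sub>R (zeta_of t - zeta_of s)"
      unfolding eta lam by (simp add: algebra_simps)
    then have "(norm (eta_of t - l))\<^sup>2 = a\<^sup>2 / (C_of t)\<^sup>2 * (norm (zeta_of t - zeta_of s))\<^sup>2"
      using a C_pos by (simp add: power_mult_distrib power_divide)
    then have quad: "C_of t * (M_of t / 2 * (norm (eta_of t - l))\<^sup>2)
        = 1/2 * (norm (zeta_of t - zeta_of s))\<^sup>2"
      using M Mt a by (simp add: a(2) power2_eq_square)
    have "C_of t *\<^sub>R eta_of t = a *\<^sub>R zeta_of t + C_of s *\<^sub>R eta_of s"
      using C_pos by (simp add: eta)
    then have "C_of t *\<^sub>R (eta_of t - l) = a *\<^sub>R (zeta_of t - l) + C_of s *\<^sub>R (eta_of s - l)"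
      unfolding scaleR_diff_right by (simp add: Ct algebra_simps)
    then have "C_of t * gf l (eta_of t - l) = a * gf l (zeta_of t - l) + C_of s * gf l (eta_of s - l)"
      by (metis blinfun.add_right blinfun.scaleR_right real_scaleR_def)
    \<comment> \<open>The linearization is affine and the weights sum to
      \<open>C_of t\<close>.\<close>
    then have lin_eta: "C_of t * lin (eta_of t) = a * lin (zeta_of t) + C_of s * lin (eta_of s)"
      by (simp add: lin_def linearization_def Ct algebra_simps)
    have "C_of t * f (eta_of t) \<le> C_of t * (lin (eta_of t) + M_of t / 2 * (norm (eta_of t - l))\<^sup>2)"
      using check C_pos by (simp add: astm_check_def lin_def l_def)
    also have "\<dots> = C_of s * lin (eta_of s) + a * lin (zeta_of t)
        + 1/2 * (norm (zeta_of t - zeta_of s))\<^sup>2"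
      unfolding distrib_left quad lin_eta by simp
    also have "\<dots> \<le> C_of s * f (eta_of s) + a * lin (zeta_of t)
        + bregman d gd (zeta_of s) (zeta_of t)"
      using bregman_lower_bound[OF \<zeta>, of "zeta_of t"]
        domain_subset[OF prox_step(1)[OF \<zeta> zeta]]
        mult_left_mono[OF convex_tangent_bound[OF convex_f deriv_f, of l "eta_of s"] C]
      by (simp add: lin_def)
    finally show ?thesis
      using prox_step(2)[OF \<zeta> zeta x] by (simp add: a_def l_def lin_def)
  qed
qed

text \<open>After \<open>k\<close> rejected checks there have been \<open>k + 1\<close> passes and
  the new \<open>L_of\<close> is \<open>2 ^ k * L_of s / 2\<close>. The logarithm of the ratio is
  thus \<open>k - 1\<close>, and \<open>2 * (k + 1) = 4 + 2 * (k - 1)\<close>; in this form the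
  counts telescope.\<close>

lemma astm_step_properties:
  assumes \<zeta>: "zeta_of s \<in> subdiff_domain S d" and C: "0 \<le> C_of s" and L_of: "0 < L_of s"
  obtains s' where "astm_step S f gf d gd s = Some s'"
    "zeta_of s' \<in> subdiff_domain S d" "0 \<le> C_of s'" "0 < L_of s'"
    "\<And>x. x \<in> S \<Longrightarrow> C_of s' * f (eta_of s') + bregman d gd (zeta_of s') x
      \<le> C_of s * f (eta_of s) + bregman d gd (zeta_of s) x
        + alpha_of s' * linearization f gf (lam_of s') x"
    "real (calls_of s') = real (calls_of s) + 4 + 2 * log 2 (L_of s' / L_of s)"
    "L_of s' \<le> max L (L_of s / 2)"
proof -
  define T where "T = astm_trial S f gf d gd s"
  define u where "u = s\<lparr>M_of := L_of s / 2\<rparr>"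
  \<comment> \<open>The index counts passes after the initial one, so \<open>P k\<close> concerns
    pass number \<open>k + 1\<close>.\<close>
  define P where "P k \<longleftrightarrow> astm_check f gf ((T ^^ k) (T u))" for k
  define k where "k = (LEAST k. P k)"
  define t where "t = (T ^^ k) (T u)"
  have M: "M_of ((T ^^ n) (T u)) = 2 ^ n * L_of s" for n
    using astm_trial_funpow(1)[of "Suc n" S f gf d gd s u]
    unfolding T_def[symmetric] funpow_Suc_right by (simp add: u_def)
  have calls: "calls_of t = calls_of s + 2 * Suc k"
    using astm_trial_funpow(2)[of "Suc k" S f gf d gd s u]
    unfolding T_def[symmetric] funpow_Suc_right by (simp add: u_def t_def)
  obtain n :: nat where "L / L_of s < 2 ^ n" using real_arch_pow[of 2] by auto
  then have "P n" unfolding P_def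
    using L_of by (intro astm_check_if_large) (simp add: M field_simps)
  then have "P k" unfolding k_def by (rule LeastI)
  then have check: "astm_check f gf t" by (simp add: P_def t_def)
  have "while_option (\<lambda>t. \<not> astm_check f gf t) T (T u) = Some t"
    using \<open>P n\<close> unfolding while_option_def t_def k_def P_def by auto
  then have step: "astm_step S f gf d gd s = Some (t\<lparr>L_of := M_of t / 2\<rparr>)"
    by (simp add: astm_step_def T_def u_def)
  have Mt: "M_of t = 2 ^ k * L_of s" by (simp add: t_def M)
  have "t = T ((T ^^ k) u)" by (simp add: t_def funpow_swap1)
  moreover have "M_of ((T ^^ k) u) > 0"
    using L_of by (simp add: T_def astm_trial_funpow u_def)
  ultimately have energy: "zeta_of t \<in> subdiff_domain S d" "0 \<le> C_of t"
    "\<And>x. x \<in> S \<Longrightarrow> C_of t * f (eta_of t) + bregman d gd (zeta_of t) x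
      \<le> C_of s * f (eta_of s) + bregman d gd (zeta_of s) x
        + alpha_of t * linearization f gf (lam_of t) x"
    using astm_trial_energy[OF \<zeta> C _ _ check] unfolding T_def by blast+
  have "M_of t / 2 / L_of s = 2 powr (real k - 1)"
    using L_of by (simp add: Mt powr_diff powr_realpow)
  then have "log 2 (M_of t / 2 / L_of s) = real k - 1" by (simp only: log_powr_cancel)
  then have count: "real (calls_of t) = real (calls_of s) + 4 + 2 * log 2 (M_of t / 2 / L_of s)"
    by (simp add: calls)
  \<comment> \<open>Either the first check succeeded, or \<open>M_of t / 2\<close> is the last
    rejected trial value, which lies below \<open>L\<close>.\<close>
  have "M_of t / 2 \<le> max L (L_of s / 2)"
  proof (cases k)
    case 0
    then show ?thesis by (simp add: Mt)
  next
    case (Suc j)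
    then have "\<not> P j" using not_less_Least[of j P] by (simp add: k_def)
    then have "M_of ((T ^^ j) (T u)) < L" unfolding P_def using astm_check_if_large not_le by blast
    then show ?thesis by (simp add: M Mt Suc)
  qed
  with step energy count L_of show ?thesis
    by (intro that[of "t\<lparr>L_of := M_of t / 2\<rparr>"]) (simp_all add: Mt)
qed

text \<open>Iterates the one-step estimates: the energy terms and the logarithms telescope. At
  \<open>k = 0\<close> the energy bound is an equality because \<open>C_of\<close> and
  \<open>alpha_of\<close> vanish. The maximum is there because \<open>L0\<close> may exceed
  \<open>L\<close>.\<close>

lemma astm_run:
  assumes x0: "x0 \<in> subdiff_domain S d" and L0: "L0 > 0"
  obtains s where "\<And>k. astm S f gf d gd x0 L0 k = Some (s k)"
    "s 0 = astm_init x0 L0"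
    "\<And>k. zeta_of (s k) \<in> subdiff_domain S d"
    "\<And>k x. x \<in> S \<Longrightarrow> C_of (s k) * f (eta_of (s k)) + bregman d gd (zeta_of (s k)) x
      \<le> (\<Sum>i\<le>k. alpha_of (s i) * linearization f gf (lam_of (s i)) x) + bregman d gd x0 x"
    "\<And>k. 0 < L_of (s k)"
    "\<And>k. real (calls_of (s k)) = 4 * real k + 2 * log 2 (L_of (s k) / L0)"
    "\<And>k. L_of (s k) \<le> max L (L0 / 2 ^ k)"
proof -
  define s where "s k = the (astm S f gf d gd x0 L0 k)" for k
  have s0: "s 0 = astm_init x0 L0" by (simp add: s_def)
  have "astm S f gf d gd x0 L0 k = Some (s k) \<and>
    zeta_of (s k) \<in> subdiff_domain S d \<and> 0 \<le> C_of (s k) \<and> 0 < L_of (s k) \<and>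
    (\<forall>x\<in>S. C_of (s k) * f (eta_of (s k)) + bregman d gd (zeta_of (s k)) x
      \<le> (\<Sum>i\<le>k. alpha_of (s i) * linearization f gf (lam_of (s i)) x) + bregman d gd x0 x) \<and>
    real (calls_of (s k)) = 4 * real k + 2 * log 2 (L_of (s k) / L0) \<and>
    L_of (s k) \<le> max L (L0 / 2 ^ k)" (is "?I k") for k
  proof (induction k)
    case 0
    then show ?case using x0 L0 by (simp add: s0 astm_init_def)
  next
    case (Suc k)
    then have IH: "astm S f gf d gd x0 L0 k = Some (s k)"
      "zeta_of (s k) \<in> subdiff_domain S d" "0 \<le> C_of (s k)" "0 < L_of (s k)"
      "\<And>x. x \<in> S \<Longrightarrow> C_of (s k) * f (eta_of (s k)) + bregman d gd (zeta_of (s k)) x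
        \<le> (\<Sum>i\<le>k. alpha_of (s i) * linearization f gf (lam_of (s i)) x) + bregman d gd x0 x"
      "real (calls_of (s k)) = 4 * real k + 2 * log 2 (L_of (s k) / L0)"
      "L_of (s k) \<le> max L (L0 / 2 ^ k)"
      by blast+
    obtain s' where s': "astm_step S f gf d gd (s k) = Some s'"
      "zeta_of s' \<in> subdiff_domain S d" "0 \<le> C_of s'" "0 < L_of s'"
      "\<And>x. x \<in> S \<Longrightarrow> C_of s' * f (eta_of s') + bregman d gd (zeta_of s') x
        \<le> C_of (s k) * f (eta_of (s k)) + bregman d gd (zeta_of (s k)) x
          + alpha_of s' * linearization f gf (lam_of s') x"
      "real (calls_of s') = real (calls_of (s k)) + 4 + 2 * log 2 (L_of s' / L_of (s k))"
      "L_of s' \<le> max L (L_of (s k) / 2)"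
      using astm_step_properties[OF IH(2-4)] by metis
    have run: "astm S f gf d gd x0 L0 (Suc k) = Some s'" using IH(1) s'(1) by simp
    have eq: "s (Suc k) = s'" unfolding s_def run by simp
    have "C_of s' * f (eta_of s') + bregman d gd (zeta_of s') x
        \<le> (\<Sum>i\<le>Suc k. alpha_of (s i) * linearization f gf (lam_of (s i)) x) + bregman d gd x0 x"
      if "x \<in> S" for x
      using IH(5)[OF that] s'(5)[OF that] by (simp add: eq)
    moreover have "real (calls_of s') = 4 * real (Suc k) + 2 * log 2 (L_of s' / L0)"
      using s'(4,6) IH(4,6) L0 by (simp add: log_divide)
    moreover have "L_of s' \<le> max L (L0 / 2 ^ Suc k)"
    proof -
      have "L0 / 2 ^ Suc k = L0 / 2 ^ k / 2" by simp
      then show ?thesis using s'(7) IH(7) L_pos unfolding le_max_iff_disj by argo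
    qed
    ultimately show ?case using run s'(2-4) unfolding eq by simp
  qed
  then show ?thesis using s0 by (intro that[of s]) blast+
qed

end

text \<open>Existence of \<open>s\<close> includes termination of every inner loop, and
  \<open>s (Suc k)\<close> is the state after outer iterations 0 to \<open>k\<close>. The premise on
  \<open>k\<close> marks where the count holds: if \<open>L\<^sub>0 > 2 ^ (k + 1) * L\<close>, each
  of these iterations accepts its first trial, and the resulting \<open>2 * (k + 1)\<close> calls
  exceed the bound.\<close>

theorem theorem1:
  fixes B :: "'a::real_normed_vector set"
    and \<Lambda> :: "'a set"
    and \<phi> d :: "'a \<Rightarrow> real"
    and grad_\<phi> grad_d :: "'a \<Rightarrow> 'a \<Rightarrow>\<^sub>L real"
    and L L\<^sub>0 :: real
    and x\<^sub>0 :: 'a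
  assumes finite_dim: "finite B" "span B = UNIV"
    and \<Lambda>: "\<Lambda> \<noteq> {}" "closed \<Lambda>" "convex \<Lambda>"
    and convex_\<phi>: "convex_on UNIV \<phi>"
    and deriv_\<phi>: "\<And>x. (\<phi> has_derivative blinfun_apply (grad_\<phi> x)) (at x)"
    and lipschitz: "L > 0" "L-lipschitz_on UNIV grad_\<phi>"
    and prox: "prox_setup \<Lambda> d grad_d"
    and init: "x\<^sub>0 \<in> subdiff_domain \<Lambda> d" "L\<^sub>0 > 0"
  shows "\<exists>s :: nat \<Rightarrow> 'a astm_state.
    (\<forall>k. astm \<Lambda> \<phi> grad_\<phi> d grad_d x\<^sub>0 L\<^sub>0 k = Some (s k)) \<and>
    (\<forall>k. \<exists>x. is_arg_min (\<lambda>y. (\<Sum>i\<le>k. alpha_of (s i) * linearization \<phi> grad_\<phi> (lam_of (s i)) y)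
                               + bregman d grad_d (zeta_of (s 0)) y) (\<lambda>y. y \<in> \<Lambda>) x \<and>
         C_of (s k) * \<phi> (eta_of (s k))
           \<le> (\<Sum>i\<le>k. alpha_of (s i) * linearization \<phi> grad_\<phi> (lam_of (s i)) x)
               + bregman d grad_d (zeta_of (s 0)) x) \<and>
    (\<forall>k. L\<^sub>0 \<le> 2 ^ (k + 1) * L \<longrightarrow>
         real (calls_of (s (Suc k))) \<le> 4 * real k + 4 + 2 * log 2 (L / L\<^sub>0))"
proof -
  have domain: "subdiff_domain \<Lambda> d \<noteq> {}" using init(1) by blast
  interpret astm_setting B \<Lambda> d grad_d \<phi> grad_\<phi> L
    by unfold_locales (fact assms domain)+
  obtain s where run: "\<And>k. astm \<Lambda> \<phi> grad_\<phi> d grad_d x\<^sub>0 L\<^sub>0 k = Some (s k)"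
    and s0: "s 0 = astm_init x\<^sub>0 L\<^sub>0"
    and dom: "\<And>k. zeta_of (s k) \<in> subdiff_domain \<Lambda> d"
    and energy: "\<And>k x. x \<in> \<Lambda> \<Longrightarrow>
      C_of (s k) * \<phi> (eta_of (s k)) + bregman d grad_d (zeta_of (s k)) x
      \<le> (\<Sum>i\<le>k. alpha_of (s i) * linearization \<phi> grad_\<phi> (lam_of (s i)) x) + bregman d grad_d x\<^sub>0 x"
    and L_of: "\<And>k. 0 < L_of (s k)"
    and calls: "\<And>k. real (calls_of (s k)) = 4 * real k + 2 * log 2 (L_of (s k) / L\<^sub>0)"
    and L_le: "\<And>k. L_of (s k) \<le> max L (L\<^sub>0 / 2 ^ k)"
    using init by (rule astm_run) (rule that)
  have zeta0: "zeta_of (s 0) = x\<^sub>0" by (simp add: s0 astm_init_def)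
  have "\<exists>x. is_arg_min (\<lambda>y. (\<Sum>i\<le>k. alpha_of (s i) * linearization \<phi> grad_\<phi> (lam_of (s i)) y)
                               + bregman d grad_d (zeta_of (s 0)) y) (\<lambda>y. y \<in> \<Lambda>) x \<and>
         C_of (s k) * \<phi> (eta_of (s k))
           \<le> (\<Sum>i\<le>k. alpha_of (s i) * linearization \<phi> grad_\<phi> (lam_of (s i)) x)
               + bregman d grad_d (zeta_of (s 0)) x" for k
  proof -
    define l where "l y = (\<Sum>i\<le>k. alpha_of (s i) * linearization \<phi> grad_\<phi> (lam_of (s i)) y)" for y
    \<comment> \<open>Rebase the sum at \<open>x\<^sub>0\<close> as one affine function, so that the
      minimum is attained.\<close>
    have "l y = l x\<^sub>0 + (\<Sum>i\<le>k. alpha_of (s i) *\<^sub>R grad_\<phi> (lam_of (s i))) (y - x\<^sub>0)" for y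
      by (simp add: l_def linearization_def blinfun.sum_left blinfun.scaleR_left blinfun.diff_right
          sum.distrib[symmetric] algebra_simps)
    then obtain x where x: "is_arg_min (\<lambda>y. l y + bregman d grad_d x\<^sub>0 y) (\<lambda>y. y \<in> \<Lambda>) x"
      using bregman_plus_affine_attains_min[OF init(1)] by metis
    then have "x \<in> \<Lambda>" by (simp add: is_arg_min_def)
    \<comment> \<open>The energy bound at the minimiser loses only this nonnegative term.\<close>
    moreover have "0 \<le> bregman d grad_d (zeta_of (s k)) x"
      using bregman_lower_bound[OF dom \<open>x \<in> \<Lambda>\<close>, of k] zero_le_power2[of "norm (x - zeta_of (s k))"]
      by linarith
    ultimately have "C_of (s k) * \<phi> (eta_of (s k)) \<le> l x + bregman d grad_d x\<^sub>0 x"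
      using energy[of x k] by (simp add: l_def)
    then show ?thesis using x unfolding zeta0 l_def by blast
  qed
  moreover have "real (calls_of (s (Suc k))) \<le> 4 * real k + 4 + 2 * log 2 (L / L\<^sub>0)"
    if k: "L\<^sub>0 \<le> 2 ^ (k + 1) * L" for k
  proof -
    \<comment> \<open>The premise on \<open>k\<close> makes the maximum in \<open>L_le\<close> equal
      to \<open>L\<close>.\<close>
    have "L\<^sub>0 / 2 ^ Suc k \<le> L" using k by (simp add: field_simps)
    then have "L_of (s (Suc k)) \<le> L" using L_le[of "Suc k"] by simp
    then have "log 2 (L_of (s (Suc k)) / L\<^sub>0) \<le> log 2 (L / L\<^sub>0)"
      using L_of[of "Suc k"] init(2) by (intro log_mono divide_right_mono) auto
    then show ?thesis using calls[of "Suc k"] by simp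
  qed
  ultimately show ?thesis using run by blast
qed

end
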